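(* Let $N,M\ge 1$ be integers and let $H^r(V)$, $r=0,1,2$, be the finite-dimensional Hilbert spaces of doubly periodic discrete $r$-forms on the $N\times M$ grid, with the operators $d^c$, $\delta^c$ and $\Delta^c=d^c\delta^c+\delta^c d^c$. For $r=0,1,2$ put $$R_{d^c}^r=\{d^c\varphi\in H^r(V):\ \varphi\in H^{r-1}(V)\},\qquad R_{\delta^c}^r=\{\delta^c\omega\in H^r(V):\ \omega\in H^{r+1}(V)\},$$ $$N_{\Delta^c}^r=\{\psi\in H^r(V):\ \Delta^c\psi=0\},$$ with $R_{d^c}^0=\{0\}$ and $R_{\delta^c}^2=\{0\}$. Then for each $r=0,1,2$ there is the direct sum decomposition $$H^r(V)=R_{d^c}^r\oplus R_{\delta^c}^r\oplus N_{\Delta^c}^r.$$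
   Context: Fix integers $N,M\ge1$. All index pairs $(k,s)$ are read cyclically: $k$ modulo $N$ and $s$ modulo $M$, with representatives $1\le k\le N$, $1\le s\le M$. Write $\tau k=k+1$, $\sigma k=k-1$ (and likewise for $s$). Let $x^{k,s}$, $e_1^{k,s},e_2^{k,s}$, $V^{k,s}$ be formal basis elements. The real vector spaces of discrete forms are: $H^0(V)$, consisting of $\varphi=\sum_{k,s}\varphi_{k,s}x^{k,s}$; $H^1(V)$, consisting of $\omega=\sum_{k,s}(\omega^1_{k,s}e_1^{k,s}+\omega^2_{k,s}e_2^{k,s})$; $H^2(V)$, consisting of $\psi=\sum_{k,s}\psi_{k,s}V^{k,s}$; all coefficients are real. (Conventionally $H^{-1}(V)=H^3(V)=0$.) Inner products $(\cdot,\cdot)_V$: $\sum_{k=1}^N\sum_{s=1}^M\varphi_{k,s}\varphi'_{k,s}$ on $H^0(V)$ and on $H^2(V)$ (with the respective coefficients), and $\sum_{k=1}^N\sum_{s=1}^M(\omega^1_{k,s}\omega'^1_{k,s}+\omega^2_{k,s}\omega'^2_{k,s})$ on $H^1(V)$. Difference operators: $\Delta_k f_{k,s}=f_{\tau k,s}-f_{k,s}$, $\Delta_s f_{k,s}=f_{k,\tau s}-f_{k,s}$. The coboundary $d^c:H^r(V)\to H^{r+1}(V)$ is $d^c\varphi=\sum_{k,s}\big((\Delta_k\varphi_{k,s})e_1^{k,s}+(\Delta_s\varphi_{k,s})e_2^{k,s}\big)$ for $\varphi\in H^0(V)$, $d^c\omega=\sum_{k,s}(\Delta_k\omega^2_{k,s}-\Delta_s\omega^1_{k,s})V^{k,s}$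 for $\omega\in H^1(V)$, and $d^c=0$ on $H^2(V)$. The discrete Hodge star is the linear map with $\ast x^{k,s}=V^{k,s}$, $\ast e_1^{k,s}=e_2^{\tau k,s}$, $\ast e_2^{k,s}=-e_1^{k,\tau s}$, $\ast V^{k,s}=x^{\tau k,\tau s}$, and $\delta^c:H^{r+1}(V)\to H^r(V)$ is $\delta^c=(-1)^{r+1}\ast^{-1}d^c\ast$, with $\delta^c=0$ on $H^0(V)$; explicitly $\delta^c\omega=\sum_{k,s}\big(-(\omega^1_{k,s}-\omega^1_{\sigma k,s})-(\omega^2_{k,s}-\omega^2_{k,\sigma s})\big)x^{k,s}$ for $\omega\in H^1(V)$ and $\delta^c\psi=\sum_{k,s}\big((\psi_{k,s}-\psi_{k,\sigma s})e_1^{k,s}-(\psi_{k,s}-\psi_{\sigma k,s})e_2^{k,s}\big)$ for $\psi\in H^2(V)$. *)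

theory Defs
  imports "HOL-Analysis.Analysis" "HOL-Library.Function_Algebras"
begin

text \<open>Pointwise scalar multiplication. Together with the additive structure of
  \<open>Function_Algebras\<close> it makes real-valued functions a \<open>real_vector\<close>.\<close>

instantiation "fun" :: (type, real_vector) real_vector
begin

definition scaleR_fun :: "real \<Rightarrow> ('a \<Rightarrow> 'b) \<Rightarrow> 'a \<Rightarrow> 'b" where
  "scaleR_fun c f = (\<lambda>x. c *\<^sub>R f x)"

instance
  by standard (simp_all add: fun_eq_iff scaleR_fun_def scaleR_add_left scaleR_add_right)

end

text \<open>
  A form is given by its coefficients. Cyclic indices are rendered by coefficient functions on
  \<open>int \<times> int\<close> that are \<open>N\<close>-periodic in \<open>k\<close> and \<open>M\<close>-periodic in \<open>s\<close>, so that \<open>\<tau>\<close> and \<open>\<sigma>\<close> are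
  \<open>+ 1\<close> and \<open>- 1\<close>. A \<open>form0\<close> holds the coefficients of \<open>x\<^sup>k\<^sup>,\<^sup>s\<close>, a \<open>form1\<close> those of
  \<open>e\<^sub>1\<^sup>k\<^sup>,\<^sup>s\<close> and \<open>e\<^sub>2\<^sup>k\<^sup>,\<^sup>s\<close>, a \<open>form2\<close> those of \<open>V\<^sup>k\<^sup>,\<^sup>s\<close>.\<close>

type_synonym grid_fun = "int \<Rightarrow> int \<Rightarrow> real"
type_synonym form0 = grid_fun
type_synonym form1 = "grid_fun \<times> grid_fun"
type_synonym form2 = grid_fun

definition doubly_periodic :: "int \<Rightarrow> int \<Rightarrow> grid_fun \<Rightarrow> bool" where
  "doubly_periodic N M f \<longleftrightarrow> (\<forall>k s. f (k + N) s = f k s \<and> f k (s + M) = f k s)"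

definition H0 :: "int \<Rightarrow> int \<Rightarrow> form0 set" where
  "H0 N M = {\<phi>. doubly_periodic N M \<phi>}"

definition H1 :: "int \<Rightarrow> int \<Rightarrow> form1 set" where
  "H1 N M = {\<omega>. doubly_periodic N M (fst \<omega>) \<and> doubly_periodic N M (snd \<omega>)}"

definition H2 :: "int \<Rightarrow> int \<Rightarrow> form2 set" where
  "H2 N M = {\<psi>. doubly_periodic N M \<psi>}"

definition inner0 :: "int \<Rightarrow> int \<Rightarrow> form0 \<Rightarrow> form0 \<Rightarrow> real" where
  "inner0 N M \<phi> \<phi>' = (\<Sum>k=1..N. \<Sum>s=1..M. \<phi> k s * \<phi>' k s)"

definition inner1 :: "int \<Rightarrow> int \<Rightarrow> form1 \<Rightarrow> form1 \<Rightarrow> real" where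
  "inner1 N M \<omega> \<omega>' =
    (\<Sum>k=1..N. \<Sum>s=1..M. fst \<omega> k s * fst \<omega>' k s + snd \<omega> k s * snd \<omega>' k s)"

definition inner2 :: "int \<Rightarrow> int \<Rightarrow> form2 \<Rightarrow> form2 \<Rightarrow> real" where
  "inner2 N M \<psi> \<psi>' = (\<Sum>k=1..N. \<Sum>s=1..M. \<psi> k s * \<psi>' k s)"

definition diff_k :: "grid_fun \<Rightarrow> grid_fun" where
  "diff_k f = (\<lambda>k s. f (k + 1) s - f k s)"

definition diff_s :: "grid_fun \<Rightarrow> grid_fun" where
  "diff_s f = (\<lambda>k s. f k (s + 1) - f k s)"

text \<open>The coboundary \<open>d\<^sup>c\<close> on 0- and 1-forms (it is zero on 2-forms).\<close>

definition d0 :: "form0 \<Rightarrow> form1" where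
  "d0 \<phi> = (diff_k \<phi>, diff_s \<phi>)"

definition d1 :: "form1 \<Rightarrow> form2" where
  "d1 \<omega> = diff_k (snd \<omega>) - diff_s (fst \<omega>)"

text \<open>The Hodge star in coefficients. Since \<open>\<ast>\<close> is given on basis elements by
  \<open>e\<^sub>1\<^sup>k\<^sup>,\<^sup>s \<mapsto> e\<^sub>2\<^sup>\<tau>\<^sup>k\<^sup>,\<^sup>s\<close>, \<open>e\<^sub>2\<^sup>k\<^sup>,\<^sup>s \<mapsto> - e\<^sub>1\<^sup>k\<^sup>,\<^sup>\<tau>\<^sup>s\<close> and \<open>V\<^sup>k\<^sup>,\<^sup>s \<mapsto> x\<^sup>\<tau>\<^sup>k\<^sup>,\<^sup>\<tau>\<^sup>s\<close>, coefficients are shifted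
  in the opposite direction.\<close>

definition star0 :: "form0 \<Rightarrow> form2" where
  "star0 \<phi> = \<phi>"

definition star1 :: "form1 \<Rightarrow> form1" where
  "star1 \<omega> = ((\<lambda>k s. - snd \<omega> k (s - 1)), (\<lambda>k s. fst \<omega> (k - 1) s))"

definition star2 :: "form2 \<Rightarrow> form0" where
  "star2 \<psi> = (\<lambda>k s. \<psi> (k - 1) (s - 1))"

text \<open>The codifferential \<open>\<delta>\<^sup>c = (-1)\<^sup>r\<^sup>+\<^sup>1 \<ast>\<^sup>-\<^sup>1 d\<^sup>c \<ast>\<close> on \<open>(r+1)\<close>-forms for \<open>r = 0\<close> and \<open>r = 1\<close> (it is
  zero on 0-forms). The stars are bijective, so \<open>inv\<close> is their genuine inverse, see below.\<close>

definition \<delta>1 :: "form1 \<Rightarrow> form0" where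
  "\<delta>1 \<omega> = - inv star0 (d1 (star1 \<omega>))"

definition \<delta>2 :: "form2 \<Rightarrow> form1" where
  "\<delta>2 \<psi> = inv star1 (d0 (star2 \<psi>))"

lemma bij_star0: "bij star0"
  by (simp add: star0_def[abs_def] bij_def)

lemma inv_star0: "inv star0 \<psi> = \<psi>"
  by (rule inv_f_eq) (use bij_star0 in \<open>auto simp: bij_def star0_def\<close>)

lemma bij_star1: "bij star1"
  by (rule o_bij[where g = "\<lambda>\<omega>. ((\<lambda>k s. snd \<omega> (k + 1) s), (\<lambda>k s. - fst \<omega> k (s + 1)))"])
    (auto simp: star1_def fun_eq_iff)

lemma inv_star1: "inv star1 \<omega> = ((\<lambda>k s. snd \<omega> (k + 1) s), (\<lambda>k s. - fst \<omega> k (s + 1)))"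
  by (rule inv_f_eq) (use bij_star1 in \<open>auto simp: bij_def star1_def fun_eq_iff\<close>)

lemma bij_star2: "bij star2"
  by (rule o_bij[where g = "\<lambda>\<psi> k s. \<psi> (k + 1) (s + 1)"]) (auto simp: star2_def fun_eq_iff)

lemma \<delta>1_explicit:
  "\<delta>1 \<omega> = (\<lambda>k s. - (fst \<omega> k s - fst \<omega> (k - 1) s) - (snd \<omega> k s - snd \<omega> k (s - 1)))"
  by (simp add: \<delta>1_def inv_star0 d1_def star1_def diff_k_def diff_s_def fun_eq_iff)

lemma \<delta>2_explicit:
  "\<delta>2 \<psi> = ((\<lambda>k s. \<psi> k s - \<psi> k (s - 1)), (\<lambda>k s. - (\<psi> k s - \<psi> (k - 1) s)))"
  by (simp add: \<delta>2_def inv_star1 d0_def star2_def diff_k_def diff_s_def fun_eq_iff)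

text \<open>\<open>\<Delta>\<^sup>c = d\<^sup>c \<delta>\<^sup>c + \<delta>\<^sup>c d\<^sup>c\<close>; on 0- and 2-forms one of the summands is zero because
  \<open>\<delta>\<^sup>c = 0\<close> on 0-forms and \<open>d\<^sup>c = 0\<close> on 2-forms.\<close>

definition laplace0 :: "form0 \<Rightarrow> form0" where
  "laplace0 \<phi> = \<delta>1 (d0 \<phi>)"

definition laplace1 :: "form1 \<Rightarrow> form1" where
  "laplace1 \<omega> = d0 (\<delta>1 \<omega>) + \<delta>2 (d1 \<omega>)"

definition laplace2 :: "form2 \<Rightarrow> form2" where
  "laplace2 \<psi> = d1 (\<delta>2 \<psi>)"

definition Rd0 :: "int \<Rightarrow> int \<Rightarrow> form0 set" where "Rd0 N M = {0}"
definition Rd1 :: "int \<Rightarrow> int \<Rightarrow> form1 set" where "Rd1 N M = d0 ` H0 N M"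
definition Rd2 :: "int \<Rightarrow> int \<Rightarrow> form2 set" where "Rd2 N M = d1 ` H1 N M"

definition R\<delta>0 :: "int \<Rightarrow> int \<Rightarrow> form0 set" where "R\<delta>0 N M = \<delta>1 ` H1 N M"
definition R\<delta>1 :: "int \<Rightarrow> int \<Rightarrow> form1 set" where "R\<delta>1 N M = \<delta>2 ` H2 N M"
definition R\<delta>2 :: "int \<Rightarrow> int \<Rightarrow> form2 set" where "R\<delta>2 N M = {0}"

definition N\<Delta>0 :: "int \<Rightarrow> int \<Rightarrow> form0 set" where "N\<Delta>0 N M = {\<psi> \<in> H0 N M. laplace0 \<psi> = 0}"
definition N\<Delta>1 :: "int \<Rightarrow> int \<Rightarrow> form1 set" where "N\<Delta>1 N M = {\<psi> \<in> H1 N M. laplace1 \<psi> = 0}"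
definition N\<Delta>2 :: "int \<Rightarrow> int \<Rightarrow> form2 set" where "N\<Delta>2 N M = {\<psi> \<in> H2 N M. laplace2 \<psi> = 0}"

definition direct_sum :: "'a::real_vector set \<Rightarrow> 'a set \<Rightarrow> 'a set \<Rightarrow> 'a set \<Rightarrow> bool" where
  "direct_sum H A B C \<longleftrightarrow>
    subspace H \<and> subspace A \<and> subspace B \<and> subspace C \<and> A \<subseteq> H \<and> B \<subseteq> H \<and> C \<subseteq> H \<and>
    (\<forall>h\<in>H. \<exists>!(a, b, c). a \<in> A \<and> b \<in> B \<and> c \<in> C \<and> h = a + b + c)"

definition pairwise_orthogonal ::
  "('a \<Rightarrow> 'a \<Rightarrow> real) \<Rightarrow> 'a set \<Rightarrow> 'a set \<Rightarrow> 'a set \<Rightarrow> bool" where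
  "pairwise_orthogonal ip A B C \<longleftrightarrow>
    (\<forall>a\<in>A. \<forall>b\<in>B. ip a b = 0) \<and> (\<forall>a\<in>A. \<forall>c\<in>C. ip a c = 0) \<and> (\<forall>b\<in>B. \<forall>c\<in>C. ip b c = 0)"

end

theory Submission
  imports Defs
begin

text \<open>
  The coboundary and the codifferential are adjoint by cyclic summation by parts. In a cochain
  complex of finite-dimensional inner product spaces the Laplacian \<open>d d\<^sup>* + e\<^sup>* e\<close> in the middle
  degree therefore vanishes exactly on the common kernel of \<open>d\<^sup>*\<close> and \<open>e\<close>, which is the orthogonal
  complement of \<open>range d + range e\<^sup>*\<close>. The cases \<open>r = 0\<close> and \<open>r = 2\<close> are instances in which the
  first or the last space of the complex is zero.
\<close>

section \<open>Finite-dimensional Hodge decomposition\<close>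

text \<open>The carrier is a subset of a larger type, since periodic forms sit among all functions
  on \<open>int \<times> int\<close>. Bilinearity, symmetry and nonnegativity are asked for on the
  whole type, but \<open>definite\<close> only on \<open>H\<close>: a sum over one period cannot see
  values outside it.\<close>

locale fin_inner_space =
  fixes H :: "'a::real_vector set" and ip :: "'a \<Rightarrow> 'a \<Rightarrow> real"
  assumes finite_span: "\<exists>S. finite S \<and> span S = H"
    and add_left: "ip (x + y) z = ip x z + ip y z"
    and scale_left: "ip (c *\<^sub>R x) z = c * ip x z"
    and sym: "ip x y = ip y x"
    and nonneg: "ip x x \<ge> 0"
    and definite: "x \<in> H \<Longrightarrow> ip x x = 0 \<Longrightarrow> x = 0"
begin

lemma subspace: "subspace H"
  using finite_span by (metis subspace_span)

lemma zero_left [simp]: "ip 0 x = 0"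
  using scale_left[of 0 0 x] by simp

lemma zero_right [simp]: "ip x 0 = 0"
  using sym[of x 0] by simp

lemma diff_left: "ip (x - y) z = ip x z - ip y z"
  using add_left[of "x - y" y z] by simp

lemma add_right: "ip z (x + y) = ip z x + ip z y"
  using add_left[of x y z] by (simp add: sym)

lemma scale_right: "ip z (c *\<^sub>R x) = c * ip z x"
  using scale_left[of c x z] by (simp add: sym)

text \<open>Gram-Schmidt as an induction on the spanning set: a new vector \<open>b\<close>
  contributes only its component orthogonal to the old span.\<close>

lemma orthogonal_projection_span:
  assumes "finite S" "S \<subseteq> H" "h \<in> H"
  shows "\<exists>a\<in>span S. \<forall>x\<in>span S. ip (h - a) x = 0"
  using assms
proof (induction S arbitrary: h rule: finite_induct)
  case empty
  then show ?case by simp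
next
  case (insert b S)
  obtain p where p: "p \<in> span S" "\<forall>x\<in>span S. ip (b - p) x = 0"
    using insert.IH[of b] insert.prems by auto
  obtain a where a: "a \<in> span S" "\<forall>x\<in>span S. ip (h - a) x = 0"
    using insert.IH[of h] insert.prems by auto
  define q where "q = b - p"
  have "span S \<subseteq> H"
    using insert.prems subspace span_minimal by (metis insert_subset)
  then have qH: "q \<in> H"
    unfolding q_def using p insert.prems subspace by (auto intro: subspace_diff)
  \<comment> \<open>The Fourier coefficient of the residual \<open>h - a\<close> along
    \<open>q\<close>. If \<open>ip q q = 0\<close>, definiteness gives \<open>q = 0\<close>, and
    orthogonality to \<open>q\<close> holds whatever value the division returns.\<close>
  define t where "t = ip (h - a) q / ip q q"
  have tq: "ip (h - a - t *\<^sub>R q) q = 0"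
  proof (cases "ip q q = 0")
    case True
    then show ?thesis using definite[OF qH] by simp
  next
    case False
    then show ?thesis by (simp add: t_def diff_left[of "h - a"] scale_left)
  qed
  have tS: "ip (h - a - t *\<^sub>R q) x = 0" if "x \<in> span S" for x
    using a p that by (simp add: diff_left[of "h - a"] scale_left q_def)
  have sub: "span S \<subseteq> span (insert b S)"
    by (simp add: span_mono subset_insertI)
  have "q \<in> span (insert b S)"
    unfolding q_def using p sub by (auto intro: span_diff span_base)
  then have "a + t *\<^sub>R q \<in> span (insert b S)"
    using a sub by (auto intro: span_add span_scale)
  moreover have "ip (h - (a + t *\<^sub>R q)) x = 0" if x: "x \<in> span (insert b S)" for x
  proof -
    obtain c where c: "x - c *\<^sub>R b \<in> span S"
      using x by (auto simp: span_insert)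
    \<comment> \<open>Since \<open>b = p + q\<close>, the vector \<open>x\<close> splits into a part
      in \<open>span S\<close> and a multiple of \<open>q\<close>, and \<open>tS\<close> and
      \<open>tq\<close> treat these separately.\<close>
    have "x - c *\<^sub>R q = (x - c *\<^sub>R b) + c *\<^sub>R p"
      by (simp add: q_def scaleR_right_diff_distrib)
    then have "x - c *\<^sub>R q \<in> span S"
      using c p by (metis span_add span_scale)
    then have "ip (h - a - t *\<^sub>R q) ((x - c *\<^sub>R q) + c *\<^sub>R q) = 0"
      by (simp only: add_right scale_right tS tq)
    then show ?thesis by (simp add: diff_diff_eq)
  qed
  ultimately show ?case by blast
qed

end

text \<open>A complex \<open>X \<rightarrow> Y \<rightarrow> Z\<close> with maps \<open>d\<close>,
  \<open>e\<close> and adjoints \<open>d'\<close>, \<open>e'\<close>, centred at the degree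
  \<open>Y\<close> to be decomposed. Linearity is asked of the two maps whose ranges become
  summands.\<close>

locale hodge_complex =
  X: fin_inner_space X ipX + Y: fin_inner_space Y ipY + Z: fin_inner_space Z ipZ
  for X :: "'a::real_vector set" and ipX
    and Y :: "'b::real_vector set" and ipY
    and Z :: "'c::real_vector set" and ipZ +
  fixes d :: "'a \<Rightarrow> 'b" and d' :: "'b \<Rightarrow> 'a" and e :: "'b \<Rightarrow> 'c" and e' :: "'c \<Rightarrow> 'b"
  assumes linear_d: "linear d" and linear_e': "linear e'"
    and d_mem: "x \<in> X \<Longrightarrow> d x \<in> Y" and d'_mem: "y \<in> Y \<Longrightarrow> d' y \<in> X"
    and e_mem: "y \<in> Y \<Longrightarrow> e y \<in> Z" and e'_mem: "z \<in> Z \<Longrightarrow> e' z \<in> Y"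
    and adjoint_d: "x \<in> X \<Longrightarrow> y \<in> Y \<Longrightarrow> ipY (d x) y = ipX x (d' y)"
    and adjoint_e: "y \<in> Y \<Longrightarrow> z \<in> Z \<Longrightarrow> ipZ (e y) z = ipY y (e' z)"
    and e_d: "x \<in> X \<Longrightarrow> e (d x) = 0"
begin

abbreviation "harmonic \<equiv> {y \<in> Y. d (d' y) + e' (e y) = 0}"

text \<open>Pairing the Laplacian of \<open>y\<close> with \<open>y\<close> yields the sum of the
  squared norms of \<open>d' y\<close> and \<open>e y\<close>, so both must vanish.\<close>

lemma harmonic_iff: "y \<in> harmonic \<longleftrightarrow> y \<in> Y \<and> d' y = 0 \<and> e y = 0"
proof (intro iffI)
  assume y: "y \<in> harmonic"
  then have mem: "y \<in> Y" "d' y \<in> X" "e y \<in> Z" by (auto simp: d'_mem e_mem)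
  have "0 = ipY (d (d' y) + e' (e y)) y" using y by simp
  also have "\<dots> = ipY (d (d' y)) y + ipY y (e' (e y))"
    by (simp add: Y.add_left Y.sym[of y "e' (e y)"])
  also have "\<dots> = ipX (d' y) (d' y) + ipZ (e y) (e y)"
    using mem by (simp add: adjoint_d adjoint_e)
  finally have "ipX (d' y) (d' y) = 0" "ipZ (e y) (e y) = 0"
    using X.nonneg[of "d' y"] Z.nonneg[of "e y"] by linarith+
  then show "y \<in> Y \<and> d' y = 0 \<and> e y = 0"
    using X.definite[OF mem(2)] Z.definite[OF mem(3)] mem(1) by simp
next
  assume "y \<in> Y \<and> d' y = 0 \<and> e y = 0"
  then show "y \<in> harmonic"
    by (simp add: linear_0[OF linear_d] linear_0[OF linear_e'])
qed

text \<open>Adjointness turns the two kernel conditions into orthogonality. For the converse it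
  suffices to test \<open>y\<close> against \<open>d (d' y)\<close> and
  \<open>e' (e y)\<close>.\<close>

lemma harmonic_iff_orthogonal:
  "y \<in> harmonic \<longleftrightarrow> y \<in> Y \<and> (\<forall>a\<in>d ` X. ipY y a = 0) \<and> (\<forall>b\<in>e' ` Z. ipY y b = 0)"
proof (intro iffI)
  assume "y \<in> harmonic"
  then have y: "y \<in> Y" "d' y = 0" "e y = 0" unfolding harmonic_iff by auto
  then have "ipY y (d x) = 0" if "x \<in> X" for x
    using that Y.sym[of y "d x"] by (simp add: adjoint_d)
  moreover have "ipY y (e' z) = 0" if "z \<in> Z" for z
    using that y adjoint_e[of y z] by simp
  ultimately show "y \<in> Y \<and> (\<forall>a\<in>d ` X. ipY y a = 0) \<and> (\<forall>b\<in>e' ` Z. ipY y b = 0)"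
    using y by simp
next
  assume *: "y \<in> Y \<and> (\<forall>a\<in>d ` X. ipY y a = 0) \<and> (\<forall>b\<in>e' ` Z. ipY y b = 0)"
  then have "ipY (d (d' y)) y = 0" "ipY y (e' (e y)) = 0"
    using d'_mem e_mem Y.sym[of "d (d' y)" y] by auto
  then have "ipX (d' y) (d' y) = 0" "ipZ (e y) (e y) = 0"
    using * by (simp_all add: adjoint_d adjoint_e d'_mem e_mem)
  then show "y \<in> harmonic"
    using * X.definite Z.definite d'_mem e_mem unfolding harmonic_iff by blast
qed

text \<open>Moving \<open>e'\<close> across the inner product produces \<open>e (d x)\<close>; this
  is where the complex property enters.\<close>

lemma exact_coexact_orthogonal: "a \<in> d ` X \<Longrightarrow> b \<in> e' ` Z \<Longrightarrow> ipY a b = 0"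
  by (auto simp: adjoint_e[symmetric] d_mem e_d)

text \<open>The locale states no linearity of \<open>d'\<close> and \<open>e\<close>, so closure is
  read off from the orthogonality description and the bilinearity of \<open>ipY\<close>.\<close>

lemma subspace_harmonic: "subspace harmonic"
  using subspace_0[OF Y.subspace] subspace_add[OF Y.subspace] subspace_scale[OF Y.subspace]
  by (intro subspaceI)
    (simp_all only: harmonic_iff_orthogonal Y.add_left Y.scale_left Y.zero_left, auto)

lemma pairwise_orthogonal: "pairwise_orthogonal ipY (d ` X) (e' ` Z) harmonic"
  unfolding pairwise_orthogonal_def
  using exact_coexact_orthogonal harmonic_iff_orthogonal Y.sym by metis

lemma image_d_finite_span: "\<exists>S. finite S \<and> S \<subseteq> Y \<and> span S = d ` X"
proof -
  obtain S where S: "finite S" "span S = X"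
    using X.finite_span by blast
  have "span (d ` S) = d ` X"
    using S linear_span_image[OF linear_d] by simp
  then show ?thesis
    using S d_mem span_superset by (metis finite_imageI image_subset_iff subset_iff)
qed

lemma image_e'_finite_span: "\<exists>S. finite S \<and> S \<subseteq> Y \<and> span S = e' ` Z"
proof -
  obtain S where S: "finite S" "span S = Z"
    using Z.finite_span by blast
  have "span (e' ` S) = e' ` Z"
    using S linear_span_image[OF linear_e'] by simp
  then show ?thesis
    using S e'_mem span_superset by (metis finite_imageI image_subset_iff subset_iff)
qed

text \<open>Project \<open>y\<close> onto each range independently. As the ranges are mutually
  orthogonal, subtracting one projection does not spoil orthogonality to the other range, so the
  remainder is harmonic.\<close>

lemma decomposition_exists:
  assumes "y \<in> Y"
  shows "\<exists>a\<in>d ` X. \<exists>b\<in>e' ` Z. \<exists>c\<in>harmonic. y = a + b + c"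
proof -
  obtain a where a: "a \<in> d ` X" "\<forall>x\<in>d ` X. ipY (y - a) x = 0"
    using image_d_finite_span Y.orthogonal_projection_span assms by metis
  obtain b where b: "b \<in> e' ` Z" "\<forall>x\<in>e' ` Z. ipY (y - b) x = 0"
    using image_e'_finite_span Y.orthogonal_projection_span assms by metis
  have "a \<in> Y" "b \<in> Y"
    using a b d_mem e'_mem by auto
  then have mem: "y - a - b \<in> Y"
    using assms Y.subspace by (simp add: subspace_diff)
  have "ipY (y - a - b) x = 0" if "x \<in> d ` X" for x
    using bspec[OF a(2) that] exact_coexact_orthogonal[OF that b(1)]
    by (simp add: Y.diff_left[of "y - a"] Y.sym[of b x])
  moreover have "ipY (y - a - b) x = 0" if "x \<in> e' ` Z" for x
    using bspec[OF b(2) that] exact_coexact_orthogonal[OF a(1) that]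
    by (simp add: Y.diff_left)
  ultimately have "y - a - b \<in> harmonic"
    using mem by (simp only: harmonic_iff_orthogonal) blast
  moreover have "y = a + b + (y - a - b)" by simp
  ultimately show ?thesis using a b by blast
qed

text \<open>Pairing the sum with \<open>a\<close> and with \<open>b\<close> leaves only their
  squared norms.\<close>

lemma orthogonal_sum_zero:
  assumes "a \<in> d ` X" "b \<in> e' ` Z" "c \<in> harmonic" "a + b + c = 0"
  shows "a = 0 \<and> b = 0 \<and> c = 0"
proof -
  have mem: "a \<in> Y" "b \<in> Y" "c \<in> Y"
    using assms d_mem e'_mem by auto
  have orth: "ipY a b = 0" "ipY a c = 0" "ipY b c = 0"
    using assms pairwise_orthogonal unfolding pairwise_orthogonal_def by blast+
  have "ipY (a + b + c) a = 0" "ipY (a + b + c) b = 0"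
    using assms by simp_all
  then have "ipY a a = 0" "ipY b b = 0"
    using orth by (simp_all add: Y.add_left Y.sym[of b a] Y.sym[of c a] Y.sym[of c b])
  then have "a = 0" "b = 0"
    using Y.definite mem by auto
  then show ?thesis
    using assms(4) by simp
qed

lemma direct_sum: "direct_sum Y (d ` X) (e' ` Z) harmonic"
proof -
  have sub: "subspace (d ` X)" "subspace (e' ` Z)"
    using image_d_finite_span image_e'_finite_span by (metis subspace_span)+
  have uniq: "\<exists>!(a, b, c). a \<in> d ` X \<and> b \<in> e' ` Z \<and> c \<in> harmonic \<and> y = a + b + c"
    if y: "y \<in> Y" for y
  proof -
    obtain a b c where abc: "a \<in> d ` X" "b \<in> e' ` Z" "c \<in> harmonic" "y = a + b + c"
      using decomposition_exists[OF y] by blast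
    show ?thesis
    proof (rule ex1I[of _ "(a, b, c)"])
      show "case (a, b, c) of (a, b, c) \<Rightarrow>
          a \<in> d ` X \<and> b \<in> e' ` Z \<and> c \<in> harmonic \<and> y = a + b + c"
        using abc by simp
    next
      fix u
      assume u: "case u of (a, b, c) \<Rightarrow>
          a \<in> d ` X \<and> b \<in> e' ` Z \<and> c \<in> harmonic \<and> y = a + b + c"
      obtain a' b' c' where [simp]: "u = (a', b', c')" by (cases u)
      have abc': "a' \<in> d ` X" "b' \<in> e' ` Z" "c' \<in> harmonic" "y = a' + b' + c'"
        using u by auto
      \<comment> \<open>The difference of two decompositions of \<open>y\<close> decomposes 0, with
        each component still in its own subspace.\<close>
      have "(a' - a) + (b' - b) + (c' - c) = (a' + b' + c') - (a + b + c)"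
        by (simp add: algebra_simps)
      also have "\<dots> = 0"
        unfolding abc(4)[symmetric] abc'(4)[symmetric] by simp
      finally have "a' - a = 0 \<and> b' - b = 0 \<and> c' - c = 0"
        by (rule orthogonal_sum_zero[OF subspace_diff[OF sub(1) abc'(1) abc(1)]
              subspace_diff[OF sub(2) abc'(2) abc(2)]
              subspace_diff[OF subspace_harmonic abc'(3) abc(3)]])
      then show "u = (a, b, c)" by simp
    qed
  qed
  have "d ` X \<subseteq> Y" "e' ` Z \<subseteq> Y" "harmonic \<subseteq> Y"
    using d_mem e'_mem by auto
  then show ?thesis
    unfolding direct_sum_def
    by (intro conjI ballI sub uniq Y.subspace subspace_harmonic)
qed

end

text \<open>Stands in for the zero spaces of forms of degree -1 and 3.\<close>

lemma fin_inner_space_zero: "fin_inner_space {0::real} (*)"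
  by unfold_locales (auto simp: algebra_simps intro: exI[of _ "{}"])

section \<open>Doubly periodic forms\<close>

lemma doubly_periodic_shift:
  assumes "doubly_periodic N M f"
  shows "f (k + i * N) (s + j * M) = f k s"
proof -
  have *: "g (x + m * L) = g x" if "\<And>x. g (x + L) = g x" for g :: "int \<Rightarrow> real" and x m L
  proof (induction m rule: int_induct[where k = 0])
    case (step1 m)
    then show ?case using that[of "x + m * L"] by (simp add: algebra_simps)
  next
    case (step2 m)
    then show ?case using that[of "x + (m - 1) * L"] by (simp add: algebra_simps)
  qed simp
  have "f (k + i * N) (s + j * M) = f (k + i * N) s"
    using assms by (intro *) (simp add: doubly_periodic_def)
  also have "\<dots> = f k s"
    using assms by (intro *[of "\<lambda>k. f k s"]) (simp add: doubly_periodic_def)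
  finally show ?thesis .
qed

text \<open>Replacing \<open>k\<close> by \<open>k + N\<close> in a difference operator creates
  arguments such as \<open>k + N + 1\<close>, which the equations in
  \<open>doubly_periodic_def\<close> do not match syntactically; these variants do.\<close>

lemma doubly_periodic_add_diff:
  assumes "doubly_periodic N M f"
  shows "f (k + N + c) s = f (k + c) s" "f (k + N - c) s = f (k - c) s"
    "f k (s + M + c) = f k (s + c)" "f k (s + M - c) = f k (s - c)"
proof -
  have "f (x + N) y = f x y" "f x (y + M) = f x y" for x y
    using assms by (simp_all add: doubly_periodic_def)
  from this(1)[of "k + c" s] this(1)[of "k - c" s] this(2)[of k "s + c"] this(2)[of k "s - c"]
  show "f (k + N + c) s = f (k + c) s" "f (k + N - c) s = f (k - c) s"
    "f k (s + M + c) = f k (s + c)" "f k (s + M - c) = f k (s - c)"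
    by (simp_all add: algebra_simps)
qed

text \<open>The shift by 1 around \<open>mod\<close> selects representatives in
  \<open>{1..N}\<close> and \<open>{1..M}\<close>, the ranges of summation, instead of ranges
  starting at 0.\<close>

lemma doubly_periodic_representative:
  assumes "doubly_periodic N M f"
  shows "f k s = f ((k - 1) mod N + 1) ((s - 1) mod M + 1)"
proof -
  have "k = ((k - 1) mod N + 1) + (k - 1) div N * N" "s = ((s - 1) mod M + 1) + (s - 1) div M * M"
    by (simp_all add: algebra_simps)
  then show ?thesis
    using doubly_periodic_shift[OF assms] by metis
qed

lemma representative_range:
  fixes k N :: int
  assumes "N \<ge> 1"
  shows "(k - 1) mod N + 1 \<in> {1..N}"
  using assms by (simp add: pos_mod_bound add1_zle_eq)

section \<open>Finite spanning sets for periodic forms\<close>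

lemma subspace_H0: "subspace (H0 N M)"
  by (intro subspaceI)
    (auto simp: H0_def doubly_periodic_def zero_fun_def plus_fun_def scaleR_fun_def)

text \<open>For \<open>i\<close> in \<open>{1..N}\<close> and \<open>j\<close> in
  \<open>{1..M}\<close> this is the basis form with coefficient 1 at the cyclic index
  \<open>(i, j)\<close>, extended periodically.\<close>

definition bump :: "int \<Rightarrow> int \<Rightarrow> int \<Rightarrow> int \<Rightarrow> grid_fun" where
  "bump N M i j = (\<lambda>k s. of_bool ((k - 1) mod N + 1 = i) * of_bool ((s - 1) mod M + 1 = j))"

lemma bump_mem_H0: "bump N M i j \<in> H0 N M"
proof -
  have "(k + N - 1) mod N = (k - 1) mod N" "(s + M - 1) mod M = (s - 1) mod M" for k s
    using mod_add_self2[of "k - 1" N] mod_add_self2[of "s - 1" M] by (simp_all add: algebra_simps)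
  then show ?thesis
    by (simp add: bump_def H0_def doubly_periodic_def)
qed

text \<open>At \<open>(k, s)\<close> only the summand indexed by the representatives of
  \<open>k\<close> and \<open>s\<close> survives; the two sums collapse one after the other.\<close>

lemma bump_expansion:
  assumes "N \<ge> 1" "M \<ge> 1" "f \<in> H0 N M"
  shows "f = (\<Sum>i=1..N. \<Sum>j=1..M. f i j *\<^sub>R bump N M i j)"
proof (intro ext)
  fix k s
  have sum_app: "(\<Sum>i\<in>I. g i) x = (\<Sum>i\<in>I. g i x)"
    for I :: "int set" and g :: "int \<Rightarrow> 'x \<Rightarrow> 'y::comm_monoid_add" and x
    by (induction I rule: infinite_finite_induct) simp_all
  have "(\<Sum>i=1..N. \<Sum>j=1..M. f i j *\<^sub>R bump N M i j) k s =
      (\<Sum>i=1..N. \<Sum>j=1..M. f i j * (of_bool ((k - 1) mod N + 1 = i) * of_bool ((s - 1) mod M + 1 = j)))"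
    by (simp add: sum_app scaleR_fun_def bump_def)
  also have "\<dots> = (\<Sum>i=1..N. of_bool ((k - 1) mod N + 1 = i) * f i ((s - 1) mod M + 1))"
  proof (intro sum.cong refl)
    fix i
    have "(\<Sum>j=1..M. f i j * (of_bool ((k - 1) mod N + 1 = i) * of_bool ((s - 1) mod M + 1 = j))) =
        (\<Sum>j=1..M. if (s - 1) mod M + 1 = j then of_bool ((k - 1) mod N + 1 = i) * f i j else 0)"
      by (intro sum.cong) auto
    also have "\<dots> = of_bool ((k - 1) mod N + 1 = i) * f i ((s - 1) mod M + 1)"
      using representative_range[OF assms(2), of s] by (subst sum.delta') simp_all
    finally show "(\<Sum>j=1..M. f i j * (of_bool ((k - 1) mod N + 1 = i) *
        of_bool ((s - 1) mod M + 1 = j))) = of_bool ((k - 1) mod N + 1 = i) * f i ((s - 1) mod M + 1)" .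
  qed
  also have "\<dots> = (\<Sum>i=1..N. if (k - 1) mod N + 1 = i then f i ((s - 1) mod M + 1) else 0)"
    by (intro sum.cong) auto
  also have "\<dots> = f ((k - 1) mod N + 1) ((s - 1) mod M + 1)"
    using representative_range[OF assms(1), of k] by (subst sum.delta') simp_all
  also have "\<dots> = f k s"
    using assms(3) doubly_periodic_representative by (metis H0_def mem_Collect_eq)
  finally show "f k s = (\<Sum>i=1..N. \<Sum>j=1..M. f i j *\<^sub>R bump N M i j) k s" by simp
qed

lemma H0_finite_span:
  assumes "N \<ge> 1" "M \<ge> 1"
  shows "\<exists>S. finite S \<and> span S = H0 N M"
proof -
  define S where "S = (\<lambda>(i, j). bump N M i j) ` ({1..N} \<times> {1..M})"
  have "H0 N M \<subseteq> span S"
  proof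
    fix f assume f: "f \<in> H0 N M"
    have "(\<Sum>i=1..N. \<Sum>j=1..M. f i j *\<^sub>R bump N M i j) \<in> span S"
      by (intro span_sum span_scale span_base) (auto simp: S_def)
    then show "f \<in> span S"
      using bump_expansion[OF assms f] by simp
  qed
  moreover have "span S \<subseteq> H0 N M"
    using bump_mem_H0 by (intro span_minimal subspace_H0) (auto simp: S_def)
  ultimately show ?thesis
    by (intro exI[of _ S]) (auto simp: S_def)
qed

text \<open>Place the two spanning sets on the two coordinate axes. This carries finite dimension
  over to \<open>H1\<close>, a product of two copies of \<open>H0\<close>.\<close>

lemma finite_span_Times:
  fixes A :: "'a::real_vector set" and B :: "'b::real_vector set"
  assumes "\<exists>S. finite S \<and> span S = A" "\<exists>T. finite T \<and> span T = B"
  shows "\<exists>S. finite S \<and> span S = A \<times> B"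
proof -
  obtain S T where S: "finite S" "span S = A" and T: "finite T" "span T = B"
    using assms by blast
  let ?f = "\<lambda>x::'a. (x, 0::'b)" and ?g = "\<lambda>y::'b. (0::'a, y)"
  have lin: "linear ?f" "linear ?g"
    by (auto intro!: linearI)
  have "span (?f ` S \<union> ?g ` T) = {x + y |x y. x \<in> ?f ` A \<and> y \<in> ?g ` B}"
    using S T by (simp add: span_Un linear_span_image[OF lin(1)] linear_span_image[OF lin(2)])
  also have "\<dots> = A \<times> B"
    by force
  finally show ?thesis
    using S T by (intro exI[of _ "?f ` S \<union> ?g ` T"]) simp
qed

section \<open>Inner product structure on forms of each degree\<close>

lemma H1_eq: "H1 N M = H0 N M \<times> H0 N M"
  by (auto simp: H1_def H0_def)

lemma H2_eq: "H2 N M = H0 N M"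
  by (simp add: H2_def H0_def)

lemma inner2_eq: "inner2 = inner0"
  by (simp add: fun_eq_iff inner2_def inner0_def)

lemma inner1_eq: "inner1 N M \<omega> \<omega>' = inner0 N M (fst \<omega>) (fst \<omega>') + inner0 N M (snd \<omega>) (snd \<omega>')"
  by (simp add: inner1_def inner0_def sum.distrib)

lemma fin_inner_space_H0:
  assumes "N \<ge> 1" "M \<ge> 1"
  shows "fin_inner_space (H0 N M) (inner0 N M)"
proof
  fix f g h :: grid_fun and c :: real
  show "\<exists>S. finite S \<and> span S = H0 N M"
    using assms by (rule H0_finite_span)
  show "inner0 N M (f + g) h = inner0 N M f h + inner0 N M g h"
    by (simp add: inner0_def sum.distrib algebra_simps)
  show "inner0 N M (c *\<^sub>R f) h = c * inner0 N M f h"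
    by (simp add: inner0_def scaleR_fun_def sum_distrib_left algebra_simps)
  show "inner0 N M f g = inner0 N M g f"
    by (simp add: inner0_def mult.commute)
  show "inner0 N M f f \<ge> 0"
    by (simp add: inner0_def sum_nonneg)
  \<comment> \<open>A vanishing sum of squares kills \<open>f\<close> on one period only;
    periodicity carries this to all indices.\<close>
  assume f: "f \<in> H0 N M" and "inner0 N M f f = 0"
  then have "\<forall>k\<in>{1..N}. \<forall>s\<in>{1..M}. f k s = 0"
    by (simp add: inner0_def sum_nonneg sum_nonneg_eq_0_iff)
  then have "f ((k - 1) mod N + 1) ((s - 1) mod M + 1) = 0" for k s
    using representative_range assms by blast
  then have "f k s = 0" for k s
    using f doubly_periodic_representative[of N M f k s] by (simp add: H0_def)
  then show "f = 0"
    by (simp add: fun_eq_iff)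
qed

lemma fin_inner_space_H1:
  assumes "N \<ge> 1" "M \<ge> 1"
  shows "fin_inner_space (H1 N M) (inner1 N M)"
proof -
  interpret H0: fin_inner_space "H0 N M" "inner0 N M"
    using assms by (rule fin_inner_space_H0)
  show ?thesis
  proof
    fix f g h :: form1 and c :: real
    show "\<exists>S. finite S \<and> span S = H1 N M"
      unfolding H1_eq by (intro finite_span_Times H0.finite_span)
    show "inner1 N M (f + g) h = inner1 N M f h + inner1 N M g h"
      by (simp add: inner1_eq H0.add_left)
    show "inner1 N M (c *\<^sub>R f) h = c * inner1 N M f h"
      by (simp add: inner1_eq H0.scale_left distrib_left)
    show "inner1 N M f g = inner1 N M g f"
      by (simp add: inner1_eq H0.sym)
    show "inner1 N M f f \<ge> 0"
      by (simp add: inner1_eq H0.nonneg)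
    assume f: "f \<in> H1 N M" and "inner1 N M f f = 0"
    then have "inner0 N M (fst f) (fst f) = 0" "inner0 N M (snd f) (snd f) = 0"
      by (simp_all add: inner1_eq add_nonneg_eq_0_iff H0.nonneg)
    then show "f = 0"
      using f H0.definite by (auto simp: H1_eq prod_eq_iff)
  qed
qed

section \<open>Summation by parts\<close>

text \<open>The shift moves the window to \<open>{2..N + 1}\<close>, and the term that enters at
  \<open>N + 1\<close> equals the one lost at 1.\<close>

lemma sum_cyclic_shift:
  fixes g :: "int \<Rightarrow> real"
  assumes "N \<ge> 1" "\<And>k. g (k + N) = g k"
  shows "(\<Sum>k=1..N. g (k + 1)) = (\<Sum>k=1..N. g k)"
proof -
  have "(\<Sum>k=1..N. g (k + 1)) = (\<Sum>k=2..N + 1. g k)"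
    by (rule sum.reindex_bij_witness[of _ "\<lambda>k. k - 1" "\<lambda>k. k + 1"]) auto
  also have "{2..N + 1} = insert (N + 1) {2..N}"
    using assms(1) by auto
  also have "(\<Sum>k\<in>\<dots>. g k) = g 1 + (\<Sum>k=2..N. g k)"
    using assms(2)[of 1] by (simp add: add.commute)
  also have "\<dots> = (\<Sum>k\<in>insert 1 {2..N}. g k)"
    by simp
  also have "insert 1 {2..N} = {1..N}"
    using assms(1) by auto
  finally show ?thesis .
qed

text \<open>The cyclic shift applied to the row sums of \<open>f k s * g (k - 1) s\<close>, whose
  translate by 1 in \<open>k\<close> is the left-hand side.\<close>

lemma sum_shift_k:
  assumes "N \<ge> 1" "doubly_periodic N M f" "doubly_periodic N M g"
  shows "(\<Sum>k=1..N. \<Sum>s=1..M. f (k + 1) s * g k s) = (\<Sum>k=1..N. \<Sum>s=1..M. f k s * g (k - 1) s)"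
proof -
  have "g (k + N - 1) s = g (k - 1) s" for k s
    using assms(3) by (rule doubly_periodic_add_diff)
  then show ?thesis
    using sum_cyclic_shift[of N "\<lambda>k. \<Sum>s=1..M. f k s * g (k - 1) s"] assms(1,2)
    by (simp add: doubly_periodic_def)
qed

lemma sum_shift_s:
  assumes "M \<ge> 1" "doubly_periodic N M f" "doubly_periodic N M g"
  shows "(\<Sum>k=1..N. \<Sum>s=1..M. f k (s + 1) * g k s) = (\<Sum>k=1..N. \<Sum>s=1..M. f k s * g k (s - 1))"
proof (rule sum.cong[OF refl])
  fix k
  have "g k (s + M - 1) = g k (s - 1)" for s
    using assms(3) by (rule doubly_periodic_add_diff)
  then show "(\<Sum>s=1..M. f k (s + 1) * g k s) = (\<Sum>s=1..M. f k s * g k (s - 1))"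
    using sum_cyclic_shift[of M "\<lambda>s. f k s * g k (s - 1)"] assms(1,2)
    by (simp add: doubly_periodic_def)
qed

text \<open>Transferring each shift to the other factor turns forward differences of
  \<open>\<phi>\<close> into negated backward differences of the components of
  \<open>\<omega>\<close>, which make up \<open>\<delta>1\<close>. No boundary terms arise because
  the grid is cyclic.\<close>

lemma adjoint_d0_\<delta>1:
  assumes "N \<ge> 1" "M \<ge> 1" "\<phi> \<in> H0 N M" "\<omega> \<in> H1 N M"
  shows "inner1 N M (d0 \<phi>) \<omega> = inner0 N M \<phi> (\<delta>1 \<omega>)"
  using sum_shift_k[of N M \<phi> "fst \<omega>"] sum_shift_s[of M N \<phi> "snd \<omega>"] assms
  by (simp add: inner1_def inner0_def d0_def diff_k_def diff_s_def \<delta>1_explicit H0_def H1_def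
      left_diff_distrib right_diff_distrib sum.distrib sum_subtractf sum_negf)

lemma adjoint_d1_\<delta>2:
  assumes "N \<ge> 1" "M \<ge> 1" "\<omega> \<in> H1 N M" "\<psi> \<in> H2 N M"
  shows "inner2 N M (d1 \<omega>) \<psi> = inner1 N M \<omega> (\<delta>2 \<psi>)"
  using sum_shift_k[of N M "snd \<omega>" \<psi>] sum_shift_s[of M N "fst \<omega>" \<psi>] assms
  by (simp add: inner1_def inner2_def d1_def diff_k_def diff_s_def \<delta>2_explicit H1_def H2_def
      left_diff_distrib right_diff_distrib sum.distrib sum_subtractf sum_negf)

text \<open>Forward differences in \<open>k\<close> and \<open>s\<close> commute.\<close>

lemma d1_d0: "d1 (d0 \<phi>) = 0"
  by (simp add: d1_def d0_def diff_k_def diff_s_def fun_eq_iff)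

section \<open>Linearity of the operators and preservation of periodicity\<close>

lemma linear_d0: "linear d0"
  by (intro linearI)
    (simp_all add: d0_def diff_k_def diff_s_def fun_eq_iff scaleR_fun_def algebra_simps)

lemma linear_d1: "linear d1"
  by (intro linearI)
    (simp_all add: d1_def diff_k_def diff_s_def fun_eq_iff scaleR_fun_def algebra_simps)

lemma linear_\<delta>1: "linear \<delta>1"
  by (intro linearI) (simp_all add: \<delta>1_explicit fun_eq_iff scaleR_fun_def algebra_simps)

lemma linear_\<delta>2: "linear \<delta>2"
  by (intro linearI) (simp_all add: \<delta>2_explicit fun_eq_iff scaleR_fun_def algebra_simps)

lemma d0_mem: "\<phi> \<in> H0 N M \<Longrightarrow> d0 \<phi> \<in> H1 N M"
  using doubly_periodic_add_diff[of N M \<phi>]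
  by (auto simp: H0_def H1_def d0_def diff_k_def diff_s_def doubly_periodic_def)

lemma d1_mem: "\<omega> \<in> H1 N M \<Longrightarrow> d1 \<omega> \<in> H2 N M"
  using doubly_periodic_add_diff[of N M "fst \<omega>"] doubly_periodic_add_diff[of N M "snd \<omega>"]
  by (auto simp: H1_def H2_def d1_def diff_k_def diff_s_def doubly_periodic_def)

lemma \<delta>1_mem: "\<omega> \<in> H1 N M \<Longrightarrow> \<delta>1 \<omega> \<in> H0 N M"
  using doubly_periodic_add_diff[of N M "fst \<omega>"] doubly_periodic_add_diff[of N M "snd \<omega>"]
  by (auto simp: H0_def H1_def \<delta>1_explicit doubly_periodic_def)

lemma \<delta>2_mem: "\<psi> \<in> H2 N M \<Longrightarrow> \<delta>2 \<psi> \<in> H1 N M"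
  using doubly_periodic_add_diff[of N M \<psi>]
  by (auto simp: H1_def H2_def \<delta>2_explicit doubly_periodic_def)

theorem proposition3p4:
  fixes N M :: int
  assumes "N \<ge> 1" and "M \<ge> 1"
  shows "(direct_sum (H0 N M) (Rd0 N M) (R\<delta>0 N M) (N\<Delta>0 N M) \<and>
          pairwise_orthogonal (inner0 N M) (Rd0 N M) (R\<delta>0 N M) (N\<Delta>0 N M)) \<and>
         (direct_sum (H1 N M) (Rd1 N M) (R\<delta>1 N M) (N\<Delta>1 N M) \<and>
          pairwise_orthogonal (inner1 N M) (Rd1 N M) (R\<delta>1 N M) (N\<Delta>1 N M)) \<and>
         (direct_sum (H2 N M) (Rd2 N M) (R\<delta>2 N M) (N\<Delta>2 N M) \<and>
          pairwise_orthogonal (inner2 N M) (Rd2 N M) (R\<delta>2 N M) (N\<Delta>2 N M))"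
proof -
  interpret H0: fin_inner_space "H0 N M" "inner0 N M"
    using assms by (rule fin_inner_space_H0)
  interpret H1: fin_inner_space "H1 N M" "inner1 N M"
    using assms by (rule fin_inner_space_H1)
  interpret H2: fin_inner_space "H2 N M" "inner2 N M"
    unfolding H2_eq inner2_eq using assms by (rule fin_inner_space_H0)
  interpret zero: fin_inner_space "{0::real}" "(*)"
    by (rule fin_inner_space_zero)
  \<comment> \<open>Degree 0 is the middle of \<open>0 \<rightarrow> H0 \<rightarrow> H1\<close>:
    the incoming map and its adjoint are zero, while \<open>d0\<close> and \<open>\<delta>1\<close>
    play the roles of \<open>e\<close> and \<open>e'\<close>.\<close>
  interpret r0: hodge_complex "{0::real}" "(*)" "H0 N M" "inner0 N M" "H1 N M" "inner1 N M"
      "\<lambda>_. 0" "\<lambda>_. 0" d0 \<delta>1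
    by (intro hodge_complex.intro hodge_complex_axioms.intro H0.fin_inner_space_axioms
        H1.fin_inner_space_axioms H2.fin_inner_space_axioms zero.fin_inner_space_axioms)
      (use assms in \<open>simp_all add: linear_zero linear_\<delta>1 linear_0[OF linear_d0] d0_mem \<delta>1_mem
        adjoint_d0_\<delta>1 subspace_0[OF H0.subspace]\<close>)
  interpret r1: hodge_complex "H0 N M" "inner0 N M" "H1 N M" "inner1 N M" "H2 N M" "inner2 N M"
      d0 \<delta>1 d1 \<delta>2
    by (intro hodge_complex.intro hodge_complex_axioms.intro H0.fin_inner_space_axioms
        H1.fin_inner_space_axioms H2.fin_inner_space_axioms zero.fin_inner_space_axioms)
      (use assms in \<open>simp_all add: linear_d0 linear_\<delta>2 d0_mem d1_mem \<delta>1_mem \<delta>2_mem d1_d0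
        adjoint_d0_\<delta>1 adjoint_d1_\<delta>2\<close>)
  \<comment> \<open>Degree 2 is the middle of \<open>H1 \<rightarrow> H2 \<rightarrow> 0\<close>,
    with \<open>d1\<close> and \<open>\<delta>2\<close> now in the roles of \<open>d\<close> and
    \<open>d'\<close>.\<close>
  interpret r2: hodge_complex "H1 N M" "inner1 N M" "H2 N M" "inner2 N M" "{0::real}" "(*)"
      d1 \<delta>2 "\<lambda>_. 0" "\<lambda>_. 0"
    by (intro hodge_complex.intro hodge_complex_axioms.intro H0.fin_inner_space_axioms
        H1.fin_inner_space_axioms H2.fin_inner_space_axioms zero.fin_inner_space_axioms)
      (use assms in \<open>simp_all add: linear_zero linear_d1 d1_mem \<delta>2_mem
        adjoint_d1_\<delta>2 subspace_0[OF H2.subspace]\<close>)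
  have "Rd0 N M = (\<lambda>_. 0) ` {0::real}" "R\<delta>2 N M = (\<lambda>_. 0) ` {0::real}"
    by (simp_all add: Rd0_def R\<delta>2_def)
  \<comment> \<open>The added zeros bring the kernels into the literal shape of
    \<open>harmonic\<close> in the three interpretations.\<close>
  moreover have "N\<Delta>0 N M = {\<psi> \<in> H0 N M. 0 + \<delta>1 (d0 \<psi>) = 0}"
    "N\<Delta>1 N M = {\<psi> \<in> H1 N M. d0 (\<delta>1 \<psi>) + \<delta>2 (d1 \<psi>) = 0}"
    "N\<Delta>2 N M = {\<psi> \<in> H2 N M. d1 (\<delta>2 \<psi>) + 0 = 0}"
    by (simp_all only: N\<Delta>0_def N\<Delta>1_def N\<Delta>2_def laplace0_def laplace1_def laplace2_def
        add_0_left add_0_right)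
  ultimately show ?thesis
    using r0.direct_sum r0.pairwise_orthogonal r1.direct_sum r1.pairwise_orthogonal
      r2.direct_sum r2.pairwise_orthogonal
    by (simp only: Rd1_def Rd2_def R\<delta>0_def R\<delta>1_def simp_thms)
qed

end
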